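(* Let $\mathfrak{q}$ be a $\mathsf{Lie}$-nilpotent Leibniz algebra of class 2. Then the Lie algebra $\mathsf{Der}_z^{\mathsf{Lie}}(\mathfrak{q})$ has a central subalgebra which is isomorphic to $T\left(\frac{\mathfrak{q}}{Z_{\mathsf{Lie}}(\mathfrak{q})},[\mathfrak{q},\mathfrak{q}]_{\mathsf{Lie}}\right)$ and which contains $(R+L)(\mathfrak{q})=\{R_x+L_x\mid x\in\mathfrak{q}\}$.
   Context: $\mathbb{K}$ is a fixed ground field with $\frac12\in\mathbb{K}$. A Leibniz algebra over $\mathbb{K}$ is a $\mathbb{K}$-vector space $\mathfrak{g}$ with a bilinear bracket satisfying $[x,[y,z]]=[[x,y],z]-[[x,z],y]$ for all $x,y,z$. Put $[x,y]_{lie}=[x,y]+[y,x]$. The $\mathsf{Lie}$-center is $Z_{\mathsf{Lie}}(\mathfrak{g})=\{z\in\mathfrak{g}\mid [g,z]_{lie}=0\ \text{for all } g\in\mathfrak{g}\}$. For two-sided ideals $\mathfrak{m},\mathfrak{n}$ of $\mathfrak{g}$, $[\mathfrak{m},\mathfrak{n}]_{\mathsf{Lie}}$ is the two-sided ideal generated by all $[m,n]_{lie}$, $m\in\mathfrak{m}$, $n\in\mathfrak{n}$. Put $\gamma_1^{\mathsf{Lie}}(\mathfrak{g})=\mathfrak{g}$, $\gamma_i^{\mathsf{Lie}}(\mathfrak{g})=[\gamma_{i-1}^{\mathsf{Lie}}(\mathfrak{g}),\mathfrak{g}]_{\mathsf{Lie}}$ for $i\ge2$. $\mathfrak{g}$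 is $\mathsf{Lie}$-nilpotent of class $c$ if $\gamma_{c+1}^{\mathsf{Lie}}(\mathfrak{g})=0$ and $\gamma_c^{\mathsf{Lie}}(\mathfrak{g})\ne0$. A $\mathsf{Lie}$-derivation of $\mathfrak{g}$ is a linear map $d:\mathfrak{g}\to\mathfrak{g}$ with $d([x,y]_{lie})=[d(x),y]_{lie}+[x,d(y)]_{lie}$ for all $x,y$; $\mathsf{Der}^{\mathsf{Lie}}(\mathfrak{g})$ is the Lie algebra of these under the commutator, and $\mathsf{Der}_z^{\mathsf{Lie}}(\mathfrak{g})$ is the Lie subalgebra of those $d$ with $d(\mathfrak{g})\subseteq Z_{\mathsf{Lie}}(\mathfrak{g})$. $R_x(y)=[y,x]$ and $L_x(y)=[x,y]$, so $(R_x+L_x)(y)=[x,y]_{lie}$. For Leibniz algebras $A,B$, $T(A,B)$ is the vector space of all linear maps $A\to B$; when $B$ has zero bracket (as is the case for $[\mathfrak{q},\mathfrak{q}]_{\mathsf{Lie}}$), $T(A,B)$ carries the pointwise, hence zero, bracket and is regarded as an abelian Lie algebra. *)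

theory Defs
  imports "HOL-Algebra.Module" "HOL-Algebra.QuotRing"
begin

text \<open>
  Algebras over a ring \<open>K\<close> are records of type \<^typ>\<open>('k, 'a) module\<close>. The record field
  \<^const>\<open>mult\<close>, on which the locale \<^locale>\<open>module\<close> imposes no condition, is used as the
  (non-associative) bracket: \<open>x \<otimes> y\<close> stands for \<open>[x, y]\<close>. The record field \<^const>\<open>one\<close> has no
  meaning for these algebras.
\<close>

locale leibniz_algebra = K?: field K + G?: module K G
  for K :: "('k, 'm) ring_scheme" (structure) and G :: "('k, 'a, 'n) module_scheme" (structure) +
  assumes bracket_closed:
      "\<lbrakk>x \<in> carrier G; y \<in> carrier G\<rbrakk> \<Longrightarrow> x \<otimes>\<^bsub>G\<^esub> y \<in> carrier G"
    and bracket_add_left: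
      "\<lbrakk>x \<in> carrier G; y \<in> carrier G; z \<in> carrier G\<rbrakk> \<Longrightarrow>
        (x \<oplus>\<^bsub>G\<^esub> y) \<otimes>\<^bsub>G\<^esub> z = x \<otimes>\<^bsub>G\<^esub> z \<oplus>\<^bsub>G\<^esub> y \<otimes>\<^bsub>G\<^esub> z"
    and bracket_add_right:
      "\<lbrakk>x \<in> carrier G; y \<in> carrier G; z \<in> carrier G\<rbrakk> \<Longrightarrow>
        x \<otimes>\<^bsub>G\<^esub> (y \<oplus>\<^bsub>G\<^esub> z) = x \<otimes>\<^bsub>G\<^esub> y \<oplus>\<^bsub>G\<^esub> x \<otimes>\<^bsub>G\<^esub> z"
    and bracket_smult_left:
      "\<lbrakk>a \<in> carrier K; x \<in> carrier G; y \<in> carrier G\<rbrakk> \<Longrightarrow>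
        (a \<odot>\<^bsub>G\<^esub> x) \<otimes>\<^bsub>G\<^esub> y = a \<odot>\<^bsub>G\<^esub> (x \<otimes>\<^bsub>G\<^esub> y)"
    and bracket_smult_right:
      "\<lbrakk>a \<in> carrier K; x \<in> carrier G; y \<in> carrier G\<rbrakk> \<Longrightarrow>
        x \<otimes>\<^bsub>G\<^esub> (a \<odot>\<^bsub>G\<^esub> y) = a \<odot>\<^bsub>G\<^esub> (x \<otimes>\<^bsub>G\<^esub> y)"
    and leibniz_identity:
      "\<lbrakk>x \<in> carrier G; y \<in> carrier G; z \<in> carrier G\<rbrakk> \<Longrightarrow>
        x \<otimes>\<^bsub>G\<^esub> (y \<otimes>\<^bsub>G\<^esub> z) = ((x \<otimes>\<^bsub>G\<^esub> y) \<otimes>\<^bsub>G\<^esub> z) \<ominus>\<^bsub>G\<^esub> ((x \<otimes>\<^bsub>G\<^esub> z) \<otimes>\<^bsub>G\<^esub> y)"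

definition bracket_subalgebra ::
  "('k, 'm) ring_scheme \<Rightarrow> ('k, 'a, 'n) module_scheme \<Rightarrow> 'a set \<Rightarrow> bool" where
  "bracket_subalgebra K G H \<longleftrightarrow>
     submodule H K G \<and> (\<forall>x\<in>H. \<forall>y\<in>H. x \<otimes>\<^bsub>G\<^esub> y \<in> H)"

definition bracket_ideal ::
  "('k, 'm) ring_scheme \<Rightarrow> ('k, 'a, 'n) module_scheme \<Rightarrow> 'a set \<Rightarrow> bool" where
  "bracket_ideal K G I \<longleftrightarrow>
     submodule I K G \<and> (\<forall>x\<in>I. \<forall>g\<in>carrier G. x \<otimes>\<^bsub>G\<^esub> g \<in> I \<and> g \<otimes>\<^bsub>G\<^esub> x \<in> I)"

definition generated_ideal ::
  "('k, 'm) ring_scheme \<Rightarrow> ('k, 'a, 'n) module_scheme \<Rightarrow> 'a set \<Rightarrow> 'a set" where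
  "generated_ideal K G X = \<Inter>{I. bracket_ideal K G I \<and> X \<subseteq> I}"

definition bracket_center :: "('k, 'a, 'n) module_scheme \<Rightarrow> 'a set" where
  "bracket_center G =
     {z \<in> carrier G. \<forall>g\<in>carrier G. g \<otimes>\<^bsub>G\<^esub> z = \<zero>\<^bsub>G\<^esub> \<and> z \<otimes>\<^bsub>G\<^esub> g = \<zero>\<^bsub>G\<^esub>}"

definition subalg :: "('k, 'a, 'n) module_scheme \<Rightarrow> 'a set \<Rightarrow> ('k, 'a, 'n) module_scheme" where
  "subalg G H = G\<lparr>carrier := H\<rparr>"

text \<open>
  The quotient extends the library's \<open>G Quot I\<close>, whose elements are the cosets of \<open>I\<close>, by the
  induced scalar multiplication.
\<close>

definition quotient_algebra ::
  "('k, 'a, 'n) module_scheme \<Rightarrow> 'a set \<Rightarrow> ('k, 'a set) module" where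
  "quotient_algebra G I =
     \<lparr>carrier = carrier (G Quot I), mult = mult (G Quot I), one = one (G Quot I),
      zero = zero (G Quot I), add = add (G Quot I),
      smult = (\<lambda>a X. \<Union>x\<in>X. I +>\<^bsub>G\<^esub> (a \<odot>\<^bsub>G\<^esub> x))\<rparr>"

text \<open>
  Maps out of \<open>A\<close> are extensional (\<^const>\<open>undefined\<close> outside \<open>carrier A\<close>), so that equality of
  functions is equality on the carrier.
\<close>

definition linear_maps ::
  "('k, 'm) ring_scheme \<Rightarrow> ('k, 'a, 'n) module_scheme \<Rightarrow> ('k, 'b, 'p) module_scheme
    \<Rightarrow> ('a \<Rightarrow> 'b) set" where
  "linear_maps K A B =
     {f \<in> carrier A \<rightarrow>\<^sub>E carrier B.
        (\<forall>x\<in>carrier A. \<forall>y\<in>carrier A. f (x \<oplus>\<^bsub>A\<^esub> y) = f x \<oplus>\<^bsub>B\<^esub> f y) \<and>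
        (\<forall>a\<in>carrier K. \<forall>x\<in>carrier A. f (a \<odot>\<^bsub>A\<^esub> x) = a \<odot>\<^bsub>B\<^esub> f x)}"

text \<open>The space \<open>T(A, B)\<close> of all linear maps, with all operations (also the bracket) pointwise.\<close>

definition T_algebra ::
  "('k, 'm) ring_scheme \<Rightarrow> ('k, 'a, 'n) module_scheme \<Rightarrow> ('k, 'b, 'p) module_scheme
    \<Rightarrow> ('k, 'a \<Rightarrow> 'b) module" where
  "T_algebra K A B =
     \<lparr>carrier = linear_maps K A B,
      mult = (\<lambda>f g. \<lambda>x\<in>carrier A. f x \<otimes>\<^bsub>B\<^esub> g x),
      one = (\<lambda>x\<in>carrier A. \<one>\<^bsub>B\<^esub>),
      zero = (\<lambda>x\<in>carrier A. \<zero>\<^bsub>B\<^esub>),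
      add = (\<lambda>f g. \<lambda>x\<in>carrier A. f x \<oplus>\<^bsub>B\<^esub> g x),
      smult = (\<lambda>a f. \<lambda>x\<in>carrier A. a \<odot>\<^bsub>B\<^esub> f x)\<rparr>"

definition bracket_iso ::
  "('k, 'm) ring_scheme \<Rightarrow> ('k, 'a, 'n) module_scheme \<Rightarrow> ('k, 'b, 'p) module_scheme
    \<Rightarrow> ('a \<Rightarrow> 'b) set" where
  "bracket_iso K A B =
     {f \<in> linear_maps K A B.
        (\<forall>x\<in>carrier A. \<forall>y\<in>carrier A. f (x \<otimes>\<^bsub>A\<^esub> y) = f x \<otimes>\<^bsub>B\<^esub> f y) \<and>
        bij_betw f (carrier A) (carrier B)}"

definition lie_sym :: "('k, 'a, 'n) module_scheme \<Rightarrow> 'a \<Rightarrow> 'a \<Rightarrow> 'a" where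
  "lie_sym G x y = (x \<otimes>\<^bsub>G\<^esub> y) \<oplus>\<^bsub>G\<^esub> (y \<otimes>\<^bsub>G\<^esub> x)"

definition Z_Lie :: "('k, 'a, 'n) module_scheme \<Rightarrow> 'a set" where
  "Z_Lie G = {z \<in> carrier G. \<forall>g\<in>carrier G. lie_sym G g z = \<zero>\<^bsub>G\<^esub>}"

definition Lie_commutator ::
  "('k, 'm) ring_scheme \<Rightarrow> ('k, 'a, 'n) module_scheme \<Rightarrow> 'a set \<Rightarrow> 'a set \<Rightarrow> 'a set" where
  "Lie_commutator K G M N = generated_ideal K G {lie_sym G m n | m n. m \<in> M \<and> n \<in> N}"

text \<open>
  The indexing starts at \<open>1\<close>. The value at \<open>0\<close> is a dummy, chosen such that no algebra is
  nilpotent of class \<open>0\<close> in the sense below.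
\<close>

fun gamma_Lie ::
  "('k, 'm) ring_scheme \<Rightarrow> ('k, 'a, 'n) module_scheme \<Rightarrow> nat \<Rightarrow> 'a set" where
  "gamma_Lie K G 0 = carrier G"
| "gamma_Lie K G (Suc 0) = carrier G"
| "gamma_Lie K G (Suc (Suc i)) = Lie_commutator K G (gamma_Lie K G (Suc i)) (carrier G)"

definition Lie_nilpotent_of_class ::
  "('k, 'm) ring_scheme \<Rightarrow> ('k, 'a, 'n) module_scheme \<Rightarrow> nat \<Rightarrow> bool" where
  "Lie_nilpotent_of_class K G c \<longleftrightarrow>
     gamma_Lie K G (c + 1) = {\<zero>\<^bsub>G\<^esub>} \<and> gamma_Lie K G c \<noteq> {\<zero>\<^bsub>G\<^esub>}"

definition Lie_derivations ::
  "('k, 'm) ring_scheme \<Rightarrow> ('k, 'a, 'n) module_scheme \<Rightarrow> ('a \<Rightarrow> 'a) set" where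
  "Lie_derivations K G =
     {d \<in> linear_maps K G G. \<forall>x\<in>carrier G. \<forall>y\<in>carrier G.
        d (lie_sym G x y) = lie_sym G (d x) y \<oplus>\<^bsub>G\<^esub> lie_sym G x (d y)}"

definition Der_Lie ::
  "('k, 'm) ring_scheme \<Rightarrow> ('k, 'a, 'n) module_scheme \<Rightarrow> ('k, 'a \<Rightarrow> 'a) module" where
  "Der_Lie K G = (T_algebra K G G)
     \<lparr>carrier := Lie_derivations K G,
      mult := (\<lambda>d e. \<lambda>x\<in>carrier G. d (e x) \<ominus>\<^bsub>G\<^esub> e (d x))\<rparr>"

definition Der_z_Lie ::
  "('k, 'm) ring_scheme \<Rightarrow> ('k, 'a, 'n) module_scheme \<Rightarrow> ('k, 'a \<Rightarrow> 'a) module" where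
  "Der_z_Lie K G = subalg (Der_Lie K G) {d \<in> Lie_derivations K G. d ` carrier G \<subseteq> Z_Lie G}"

definition R_op :: "('k, 'a, 'n) module_scheme \<Rightarrow> 'a \<Rightarrow> 'a \<Rightarrow> 'a" where
  "R_op G x = (\<lambda>y\<in>carrier G. y \<otimes>\<^bsub>G\<^esub> x)"

definition L_op :: "('k, 'a, 'n) module_scheme \<Rightarrow> 'a \<Rightarrow> 'a \<Rightarrow> 'a" where
  "L_op G x = (\<lambda>y\<in>carrier G. x \<otimes>\<^bsub>G\<^esub> y)"

definition RL_image ::
  "('k, 'm) ring_scheme \<Rightarrow> ('k, 'a, 'n) module_scheme \<Rightarrow> ('a \<Rightarrow> 'a) set" where
  "RL_image K G = {R_op G x \<oplus>\<^bsub>T_algebra K G G\<^esub> L_op G x | x. x \<in> carrier G}"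

end

(*
  Write J = [Q, Q]_Lie and Z = Z_Lie(Q). The Leibniz identity gives [x, [y, z]_lie] = 0, so J
  annihilates Q from the right; in class 2 also J <= Z, hence J annihilates Q from both sides. In
  particular every subspace of J is an ideal, and a derivation with values in Z, which kills all
  [x, y]_lie, kills J. The central subalgebra is S = {f : Q -> J linear | f(Z) = 0}: for d with
  values in Z both compositions of f and d vanish. It is T(Q/Z, J) by the universal property of Q/Z.
*)

theory Submission
  imports Defs
begin

section \<open>Submodules and the module of linear maps\<close>

context module
begin

text \<open>Closure under negation comes for free from scalar multiplication, because the negative
  of \<open>x\<close> is (-1) times \<open>x\<close>.\<close>

lemma submoduleI_smult:
  assumes "H \<subseteq> carrier M" "\<zero>\<^bsub>M\<^esub> \<in> H"
    and "\<And>x y. \<lbrakk>x \<in> H; y \<in> H\<rbrakk> \<Longrightarrow> x \<oplus>\<^bsub>M\<^esub> y \<in> H"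
    and smult: "\<And>a x. \<lbrakk>a \<in> carrier R; x \<in> H\<rbrakk> \<Longrightarrow> a \<odot>\<^bsub>M\<^esub> x \<in> H"
  shows "submodule H R M"
proof (rule submoduleI)
  fix x assume "x \<in> H"
  then have "\<ominus>\<^bsub>M\<^esub> x = (\<ominus> \<one>) \<odot>\<^bsub>M\<^esub> x"
    using assms(1) by (auto simp: smult_l_minus)
  then show "\<ominus>\<^bsub>M\<^esub> x \<in> H"
    using smult[of "\<ominus> \<one>" x] \<open>x \<in> H\<close> by simp
qed (use assms in auto)

lemma submodule_zero:
  assumes "submodule H R M"
  shows "\<zero>\<^bsub>M\<^esub> \<in> H"
  using subgroup.one_closed[OF submodule.axioms(1)[OF assms]] by simp

lemma submodule_Inter:
  assumes "F \<noteq> {}" "\<And>H. H \<in> F \<Longrightarrow> submodule H R M"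
  shows "submodule (\<Inter>F) R M"
  using assms submoduleE(1,4,5)[OF assms(2)] submodule_zero[OF assms(2)]
  by (intro submoduleI_smult) fast+

text \<open>The predicate \<open>submodule\<close> does not look at the bracket, so
  \<open>mult\<close> may be replaced freely. This matters for \<open>Der_z_Lie\<close>, which
  carries the commutator in place of the pointwise bracket of \<open>T_algebra\<close>.\<close>

lemma submodule_incl:
  assumes "submodule H R M" "submodule D R M" "H \<subseteq> D"
  shows "submodule H R (M\<lparr>mult := m, carrier := D\<rparr>)"
proof -
  have "subgroup H (add_monoid M\<lparr>carrier := D\<rparr>)"
    using assms by (intro add.subgroup_incl submodule.axioms(1))
  then show ?thesis
    using submodule.smult_closed[OF assms(1)]
    by (intro submodule.intro submodule_axioms.intro) simp_all
qed

lemma linear_map_zero: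
  assumes "f \<in> linear_maps R M B" "module R B"
  shows "f \<zero>\<^bsub>M\<^esub> = \<zero>\<^bsub>B\<^esub>"
proof -
  interpret B: module R B by fact
  have "f \<zero>\<^bsub>M\<^esub> \<in> carrier B"
    using assms(1) by (auto simp: linear_maps_def)
  moreover have "f (\<zero> \<odot>\<^bsub>M\<^esub> \<zero>\<^bsub>M\<^esub>) = \<zero> \<odot>\<^bsub>B\<^esub> f \<zero>\<^bsub>M\<^esub>"
    using assms(1) unfolding linear_maps_def by blast
  ultimately show ?thesis by simp
qed

lemma T_algebra_module:
  assumes "module R B"
  shows "module R (T_algebra R M B)"
proof -
  interpret B: module R B by fact
  have closed: "f x \<in> carrier B" if "f \<in> linear_maps R M B" "x \<in> carrier M" for f x
    using that by (auto simp: linear_maps_def)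
  \<comment> \<open>Serves twice below: with the scalar -1 it supplies the additive inverse of
    \<open>f\<close>, with a general scalar the closure under scalar multiplication.\<close>
  have cl: "(\<lambda>x\<in>carrier M. a \<odot>\<^bsub>B\<^esub> f x) \<in> linear_maps R M B"
    if "a \<in> carrier R" "f \<in> linear_maps R M B" for a f
    using that closed[OF that(2)]
    by (auto simp: linear_maps_def B.smult_r_distr B.smult_assoc1[symmetric] R.m_comm)
  have "abelian_group (T_algebra R M B)"
  proof (rule abelian_groupI)
    fix f g assume "f \<in> carrier (T_algebra R M B)" "g \<in> carrier (T_algebra R M B)"
    then have fg: "f \<in> linear_maps R M B" "g \<in> linear_maps R M B"
      by (auto simp: T_algebra_def)
    show "f \<oplus>\<^bsub>T_algebra R M B\<^esub> g \<in> carrier (T_algebra R M B)"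
      using fg closed[OF fg(1)] closed[OF fg(2)]
      by (auto simp: T_algebra_def linear_maps_def B.a_ac B.smult_r_distr)
    show "f \<oplus>\<^bsub>T_algebra R M B\<^esub> g = g \<oplus>\<^bsub>T_algebra R M B\<^esub> f"
      using closed[OF fg(1)] closed[OF fg(2)]
      by (auto simp: T_algebra_def B.a_ac intro!: restrict_ext)
  next
    fix f assume "f \<in> carrier (T_algebra R M B)"
    then have f: "f \<in> linear_maps R M B"
      by (auto simp: T_algebra_def)
    then have ext: "f \<in> extensional (carrier M)"
      by (auto simp: linear_maps_def PiE_def)
    show "\<zero>\<^bsub>T_algebra R M B\<^esub> \<oplus>\<^bsub>T_algebra R M B\<^esub> f = f"
      using closed[OF f] by (intro extensionalityI[OF _ ext]) (auto simp: T_algebra_def)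
    show "\<exists>g\<in>carrier (T_algebra R M B). g \<oplus>\<^bsub>T_algebra R M B\<^esub> f = \<zero>\<^bsub>T_algebra R M B\<^esub>"
      using cl[of "\<ominus> \<one>" f] f closed[OF f]
      by (intro bexI[of _ "\<lambda>x\<in>carrier M. (\<ominus> \<one>) \<odot>\<^bsub>B\<^esub> f x"])
         (auto simp: T_algebra_def B.smult_l_minus B.l_neg intro!: restrict_ext)
  next
    fix f g h
    assume "f \<in> carrier (T_algebra R M B)" "g \<in> carrier (T_algebra R M B)"
      "h \<in> carrier (T_algebra R M B)"
    then show "f \<oplus>\<^bsub>T_algebra R M B\<^esub> g \<oplus>\<^bsub>T_algebra R M B\<^esub> h
        = f \<oplus>\<^bsub>T_algebra R M B\<^esub> (g \<oplus>\<^bsub>T_algebra R M B\<^esub> h)"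
      using closed[of f] closed[of g] closed[of h]
      by (auto simp: T_algebra_def B.a_ac intro!: restrict_ext)
  qed (auto simp: T_algebra_def linear_maps_def)
  then show ?thesis
  proof (rule moduleI[rotated])
    fix f assume "f \<in> carrier (T_algebra R M B)"
    then have f: "f \<in> linear_maps R M B"
      by (auto simp: T_algebra_def)
    then have ext: "f \<in> extensional (carrier M)"
      by (auto simp: linear_maps_def PiE_def)
    show "\<one> \<odot>\<^bsub>T_algebra R M B\<^esub> f = f"
      using closed[OF f] by (intro extensionalityI[OF _ ext]) (auto simp: T_algebra_def)
  qed (use cl closed in \<open>auto simp: T_algebra_def B.smult_r_distr B.smult_l_distr
        B.smult_assoc1 R.cring_axioms intro!: restrict_ext\<close>)
qed

section \<open>Quotient modules and their universal property\<close>

lemma quotient_algebra_simps: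
  assumes "submodule N R M"
  shows "carrier (quotient_algebra M N) = (\<lambda>x. N +>\<^bsub>M\<^esub> x) ` carrier M"
    and "\<lbrakk>x \<in> carrier M; y \<in> carrier M\<rbrakk> \<Longrightarrow>
      (N +>\<^bsub>M\<^esub> x) \<oplus>\<^bsub>quotient_algebra M N\<^esub> (N +>\<^bsub>M\<^esub> y) = N +>\<^bsub>M\<^esub> (x \<oplus>\<^bsub>M\<^esub> y)"
    and "\<lbrakk>a \<in> carrier R; x \<in> carrier M\<rbrakk> \<Longrightarrow>
      a \<odot>\<^bsub>quotient_algebra M N\<^esub> (N +>\<^bsub>M\<^esub> x) = N +>\<^bsub>M\<^esub> (a \<odot>\<^bsub>M\<^esub> x)"
proof -
  interpret N: abelian_subgroup N M
    using submodule.axioms(1)[OF assms] M.abelian_group_axioms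
    by (intro abelian_subgroupI3 additive_subgroup.intro)
  show "carrier (quotient_algebra M N) = (\<lambda>x. N +>\<^bsub>M\<^esub> x) ` carrier M"
    by (auto simp: quotient_algebra_def FactRing_def A_RCOSETS_def')
  show "(N +>\<^bsub>M\<^esub> x) \<oplus>\<^bsub>quotient_algebra M N\<^esub> (N +>\<^bsub>M\<^esub> y) = N +>\<^bsub>M\<^esub> (x \<oplus>\<^bsub>M\<^esub> y)"
    if "x \<in> carrier M" "y \<in> carrier M"
    using that by (simp add: quotient_algebra_def FactRing_def N.a_rcos_sum)
  show "a \<odot>\<^bsub>quotient_algebra M N\<^esub> (N +>\<^bsub>M\<^esub> x) = N +>\<^bsub>M\<^esub> (a \<odot>\<^bsub>M\<^esub> x)"
    if ax: "a \<in> carrier R" "x \<in> carrier M"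
  proof -
    \<comment> \<open>The scalar multiple of a coset is a union over all representatives
      \<open>y\<close>. Each of them contributes the same coset, so the union collapses to
      it.\<close>
    have "N +>\<^bsub>M\<^esub> (a \<odot>\<^bsub>M\<^esub> y) = N +>\<^bsub>M\<^esub> (a \<odot>\<^bsub>M\<^esub> x)" if y: "y \<in> N +>\<^bsub>M\<^esub> x" for y
    proof -
      obtain h where h: "h \<in> N" "y = h \<oplus>\<^bsub>M\<^esub> x"
        using y by (auto simp: a_r_coset_def')
      have "a \<odot>\<^bsub>M\<^esub> y = a \<odot>\<^bsub>M\<^esub> h \<oplus>\<^bsub>M\<^esub> a \<odot>\<^bsub>M\<^esub> x"
        using h ax by (simp add: smult_r_distr)
      then have "a \<odot>\<^bsub>M\<^esub> y \<in> N +>\<^bsub>M\<^esub> (a \<odot>\<^bsub>M\<^esub> x)"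
        using submodule.smult_closed[OF assms ax(1) h(1)] by (auto simp: a_r_coset_def')
      then show ?thesis
        using N.a_repr_independence' ax by auto
    qed
    moreover have "x \<in> N +>\<^bsub>M\<^esub> x"
      using ax by (simp add: N.a_rcos_self)
    ultimately have "(\<Union>y\<in>N +>\<^bsub>M\<^esub> x. N +>\<^bsub>M\<^esub> (a \<odot>\<^bsub>M\<^esub> y)) = N +>\<^bsub>M\<^esub> (a \<odot>\<^bsub>M\<^esub> x)"
      by blast
    then show ?thesis
      by (simp add: quotient_algebra_def)
  qed
qed

text \<open>The map induced by \<open>f\<close> on cosets. If \<open>f\<close> vanishes on
  \<open>N\<close>, it is constant on each coset, and \<open>the_elem\<close> extracts that value.
  The restriction to the carrier gives the extensional form that \<open>linear_maps\<close>
  demands.\<close>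

definition quotient_lift :: "'c set \<Rightarrow> ('c \<Rightarrow> 'e) \<Rightarrow> 'c set \<Rightarrow> 'e" where
  "quotient_lift N f = (\<lambda>C\<in>carrier (quotient_algebra M N). the_elem (f ` C))"

lemma quotient_lift_coset:
  assumes N: "submodule N R M" and B: "module R B"
    and f: "f \<in> linear_maps R M B" and ker: "\<And>z. z \<in> N \<Longrightarrow> f z = \<zero>\<^bsub>B\<^esub>"
    and x: "x \<in> carrier M"
  shows "quotient_lift N f (N +>\<^bsub>M\<^esub> x) = f x"
proof -
  interpret B: module R B by fact
  have "f (h \<oplus>\<^bsub>M\<^esub> x) = f x" if "h \<in> N" for h
  proof -
    have "f (h \<oplus>\<^bsub>M\<^esub> x) = f h \<oplus>\<^bsub>B\<^esub> f x" "f x \<in> carrier B"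
      using f x that submoduleE(1)[OF N] by (auto simp: linear_maps_def)
    then show ?thesis
      using ker[OF that] by simp
  qed
  moreover have "N +>\<^bsub>M\<^esub> x = (\<lambda>h. h \<oplus>\<^bsub>M\<^esub> x) ` N"
    by (auto simp: a_r_coset_def')
  \<comment> \<open>That \<open>N\<close> contains zero makes the coset nonempty, so the image is a
    singleton and not the empty set.\<close>
  ultimately have "f ` (N +>\<^bsub>M\<^esub> x) = {f x}"
    using submodule_zero[OF N] by (auto simp: image_image)
  then show ?thesis
    using x quotient_algebra_simps(1)[OF N] by (simp add: quotient_lift_def)
qed

text \<open>Injectivity: \<open>f\<close> can be read off from its lift on cosets. Surjectivity: a
  linear map on the quotient is the lift of its composition with the projection.\<close>

lemma quotient_lift_bij:
  assumes N: "submodule N R M" and B: "module R B"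
  shows "bij_betw (quotient_lift N) {f \<in> linear_maps R M B. \<forall>z\<in>N. f z = \<zero>\<^bsub>B\<^esub>}
    (linear_maps R (quotient_algebra M N) B)"
proof (rule bij_betwI')
  let ?Q = "quotient_algebra M N"
  let ?S = "{f \<in> linear_maps R M B. \<forall>z\<in>N. f z = \<zero>\<^bsub>B\<^esub>}"
  note simps = quotient_algebra_simps[OF N]
  note coset = quotient_lift_coset[OF N B]
  fix f assume f: "f \<in> ?S"
  show "quotient_lift N f \<in> linear_maps R ?Q B"
    using f unfolding linear_maps_def[of R ?Q B]
    by (auto simp: simps coset image_iff)
       (auto simp: quotient_lift_def simps linear_maps_def)
  fix g assume g: "g \<in> ?S"
  show "quotient_lift N f = quotient_lift N g \<longleftrightarrow> f = g"
  proof
    assume eq: "quotient_lift N f = quotient_lift N g"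
    have "f x = g x" if "x \<in> carrier M" for x
      using that eq f g coset[of f x] coset[of g x] by simp
    then show "f = g"
      using f g by (intro extensionalityI[of f "carrier M" g]) (auto simp: linear_maps_def PiE_def)
  qed simp
next
  let ?Q = "quotient_algebra M N"
  let ?S = "{f \<in> linear_maps R M B. \<forall>z\<in>N. f z = \<zero>\<^bsub>B\<^esub>}"
  interpret N: abelian_subgroup N M
    using submodule.axioms(1)[OF N] M.abelian_group_axioms
    by (intro abelian_subgroupI3 additive_subgroup.intro)
  note simps = quotient_algebra_simps[OF N]
  fix g assume g: "g \<in> linear_maps R ?Q B"
  define f where "f = (\<lambda>x\<in>carrier M. g (N +>\<^bsub>M\<^esub> x))"
  have f: "f \<in> linear_maps R M B"
    using g by (auto simp: linear_maps_def f_def simps simp flip: simps(2,3))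
  have "f z = \<zero>\<^bsub>B\<^esub>" if "z \<in> N" for z
  proof -
    \<comment> \<open>All elements of \<open>N\<close>, zero included, have the same coset
      \<open>N\<close>, so \<open>f\<close> takes the same value on them.\<close>
    have "f z = f \<zero>\<^bsub>M\<^esub>"
      using that submoduleE(1)[OF N] N.a_rcos_const[OF that] N.a_rcos_const[of "\<zero>\<^bsub>M\<^esub>"]
        submodule_zero[OF N]
      by (auto simp: f_def)
    then show ?thesis
      using linear_map_zero[OF f B] by simp
  qed
  then have "f \<in> ?S"
    using f by simp
  \<comment> \<open>Equality of functions is needed for every argument; outside the carrier both
    sides are \<open>undefined\<close>.\<close>
  moreover have "g C = quotient_lift N f C" for C
  proof (cases "C \<in> carrier ?Q")
    case True
    then show ?thesis
      using quotient_lift_coset[OF N B f] \<open>f \<in> ?S\<close> by (auto simp: simps f_def)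
  next
    case False
    then show ?thesis
      using g by (auto simp: quotient_lift_def linear_maps_def)
  qed
  ultimately show "\<exists>f\<in>?S. g = quotient_lift N f"
    by blast
qed

end

section \<open>The symmetrized bracket and Lie-commutator ideals in a Leibniz algebra\<close>

context leibniz_algebra
begin

lemma bracket_zero [simp]:
  assumes "x \<in> carrier G"
  shows "\<zero>\<^bsub>G\<^esub> \<otimes>\<^bsub>G\<^esub> x = \<zero>\<^bsub>G\<^esub>" "x \<otimes>\<^bsub>G\<^esub> \<zero>\<^bsub>G\<^esub> = \<zero>\<^bsub>G\<^esub>"
  using bracket_smult_left[of "\<zero>\<^bsub>K\<^esub>" "\<zero>\<^bsub>G\<^esub>" x] bracket_smult_right[of "\<zero>\<^bsub>K\<^esub>" x "\<zero>\<^bsub>G\<^esub>"]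
    assms by (simp_all add: bracket_closed)

lemma lie_sym_closed [simp, intro]:
  "\<lbrakk>x \<in> carrier G; y \<in> carrier G\<rbrakk> \<Longrightarrow> lie_sym G x y \<in> carrier G"
  by (simp add: lie_sym_def bracket_closed)

lemma lie_sym_commute:
  "\<lbrakk>x \<in> carrier G; y \<in> carrier G\<rbrakk> \<Longrightarrow> lie_sym G x y = lie_sym G y x"
  by (simp add: lie_sym_def bracket_closed G.M.a_comm)

lemma lie_sym_add_right:
  "\<lbrakk>x \<in> carrier G; y \<in> carrier G; z \<in> carrier G\<rbrakk> \<Longrightarrow>
    lie_sym G x (y \<oplus>\<^bsub>G\<^esub> z) = lie_sym G x y \<oplus>\<^bsub>G\<^esub> lie_sym G x z"
  by (simp add: lie_sym_def bracket_closed bracket_add_left bracket_add_right G.M.a_ac)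

lemma lie_sym_add_left:
  "\<lbrakk>x \<in> carrier G; y \<in> carrier G; z \<in> carrier G\<rbrakk> \<Longrightarrow>
    lie_sym G (x \<oplus>\<^bsub>G\<^esub> y) z = lie_sym G x z \<oplus>\<^bsub>G\<^esub> lie_sym G y z"
  by (simp add: lie_sym_commute[of _ z] lie_sym_add_right)

lemma lie_sym_smult_right:
  "\<lbrakk>a \<in> carrier K; x \<in> carrier G; y \<in> carrier G\<rbrakk> \<Longrightarrow>
    lie_sym G x (a \<odot>\<^bsub>G\<^esub> y) = a \<odot>\<^bsub>G\<^esub> lie_sym G x y"
  by (simp add: lie_sym_def bracket_closed bracket_smult_left bracket_smult_right G.smult_r_distr)

lemma lie_sym_smult_left:
  "\<lbrakk>a \<in> carrier K; x \<in> carrier G; y \<in> carrier G\<rbrakk> \<Longrightarrow>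
    lie_sym G (a \<odot>\<^bsub>G\<^esub> x) y = a \<odot>\<^bsub>G\<^esub> lie_sym G x y"
  by (simp add: lie_sym_commute[of _ y] lie_sym_smult_right)

lemma lie_sym_zero [simp]:
  "x \<in> carrier G \<Longrightarrow> lie_sym G x \<zero>\<^bsub>G\<^esub> = \<zero>\<^bsub>G\<^esub>"
  "x \<in> carrier G \<Longrightarrow> lie_sym G \<zero>\<^bsub>G\<^esub> x = \<zero>\<^bsub>G\<^esub>"
  by (simp_all add: lie_sym_def)

text \<open>The instances of \<open>leibniz_identity\<close> for \<open>y\<close>, \<open>z\<close>
  and for \<open>z\<close>, \<open>y\<close> are negatives of each other and cancel.\<close>

lemma bracket_lie_sym:
  assumes "x \<in> carrier G" "y \<in> carrier G" "z \<in> carrier G"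
  shows "x \<otimes>\<^bsub>G\<^esub> lie_sym G y z = \<zero>\<^bsub>G\<^esub>"
proof -
  have "x \<otimes>\<^bsub>G\<^esub> lie_sym G y z = (x \<otimes>\<^bsub>G\<^esub> y \<otimes>\<^bsub>G\<^esub> z \<ominus>\<^bsub>G\<^esub> x \<otimes>\<^bsub>G\<^esub> z \<otimes>\<^bsub>G\<^esub> y)
      \<oplus>\<^bsub>G\<^esub> (x \<otimes>\<^bsub>G\<^esub> z \<otimes>\<^bsub>G\<^esub> y \<ominus>\<^bsub>G\<^esub> x \<otimes>\<^bsub>G\<^esub> y \<otimes>\<^bsub>G\<^esub> z)"
    using assms by (simp add: lie_sym_def bracket_add_right bracket_closed leibniz_identity)
  also have "\<dots> = \<zero>\<^bsub>G\<^esub>"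
    using assms by (simp add: bracket_closed a_minus_def G.M.a_assoc G.M.r_neg1 G.M.r_neg)
  finally show ?thesis .
qed

lemma submodule_Z_Lie: "submodule (Z_Lie G) K G"
  by (rule submoduleI_smult)
     (auto simp: Z_Lie_def lie_sym_add_right lie_sym_smult_right)

lemma bracket_ideal_carrier: "bracket_ideal K G (carrier G)"
  by (simp add: bracket_ideal_def carrier_is_submodule bracket_closed)

lemma generated_ideal_minimal:
  "\<lbrakk>bracket_ideal K G I; X \<subseteq> I\<rbrakk> \<Longrightarrow> generated_ideal K G X \<subseteq> I"
  by (auto simp: generated_ideal_def)

lemma submodule_generated_ideal:
  assumes "X \<subseteq> carrier G"
  shows "submodule (generated_ideal K G X) K G"
  \<comment> \<open>The intersected family is nonempty: \<open>carrier G\<close> is an ideal, and it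
    contains \<open>X\<close> by assumption.\<close>
  unfolding generated_ideal_def using assms bracket_ideal_carrier
  by (intro submodule_Inter) (auto simp: bracket_ideal_def)

lemma Lie_commutatorI:
  "\<lbrakk>x \<in> M; y \<in> N\<rbrakk> \<Longrightarrow> lie_sym G x y \<in> Lie_commutator K G M N"
  by (auto simp: Lie_commutator_def generated_ideal_def)

lemma submodule_Lie_commutator:
  assumes "M \<subseteq> carrier G" "N \<subseteq> carrier G"
  shows "submodule (Lie_commutator K G M N) K G"
  unfolding Lie_commutator_def using assms by (intro submodule_generated_ideal) auto

text \<open>The induction principle for \<open>Lie_commutator\<close>: a property holds on all of it
  as soon as the elements with that property form an ideal containing the generators.\<close>

lemma Lie_commutator_minimal:
  assumes "bracket_ideal K G I" "\<And>x y. \<lbrakk>x \<in> M; y \<in> N\<rbrakk> \<Longrightarrow> lie_sym G x y \<in> I"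
  shows "Lie_commutator K G M N \<subseteq> I"
  unfolding Lie_commutator_def using assms by (intro generated_ideal_minimal) auto

lemma bracket_Lie_commutator:
  assumes "x \<in> carrier G" "j \<in> Lie_commutator K G (carrier G) (carrier G)"
  shows "x \<otimes>\<^bsub>G\<^esub> j = \<zero>\<^bsub>G\<^esub>"
proof -
  let ?I = "{a \<in> carrier G. \<forall>x\<in>carrier G. x \<otimes>\<^bsub>G\<^esub> a = \<zero>\<^bsub>G\<^esub>}"
  have "submodule ?I K G"
    by (rule submoduleI_smult) (auto simp: bracket_add_right bracket_smult_right)
  \<comment> \<open>For \<open>a\<close> in \<open>?I\<close> every product [g, a] is zero. For
    [a, g] the Leibniz identity yields [x, [a, g]] = [[x, a], g] - [[x, g], a], where both terms
    vanish.\<close>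
  then have "bracket_ideal K G ?I"
    by (auto simp: bracket_ideal_def bracket_closed leibniz_identity a_minus_def)
  then have "Lie_commutator K G (carrier G) (carrier G) \<subseteq> ?I"
    by (rule Lie_commutator_minimal) (auto simp: bracket_lie_sym)
  then show ?thesis
    using assms by auto
qed

end

section \<open>Class 2: the ideal \<open>J\<close>, the derivations \<open>D\<close> and the maps
  \<open>S\<close>\<close>

locale leibniz_algebra_class_2 = leibniz_algebra +
  assumes class_2: "Lie_nilpotent_of_class K G 2"
begin

abbreviation J where "J \<equiv> Lie_commutator K G (carrier G) (carrier G)"

text \<open>Written with codomain \<open>subalg G J\<close>, so that it is literally the domain of
  the bijection in \<open>quotient_lift_bij\<close>; \<open>S_iff\<close> turns its members into
  endomorphisms of \<open>G\<close>.\<close>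

abbreviation S where "S \<equiv> {f \<in> linear_maps K G (subalg G J). \<forall>z\<in>Z_Lie G. f z = \<zero>\<^bsub>subalg G J\<^esub>}"

abbreviation D where "D \<equiv> {d \<in> Lie_derivations K G. d ` carrier G \<subseteq> Z_Lie G}"

lemma J_submodule: "submodule J K G"
  by (rule submodule_Lie_commutator) auto

lemma J_closed: "j \<in> J \<Longrightarrow> j \<in> carrier G"
  using submoduleE(1)[OF J_submodule] by auto

lemma J_le_Z_Lie: "J \<subseteq> Z_Lie G"
proof
  fix j assume j: "j \<in> J"
  \<comment> \<open>This ideal is the third term of the series \<open>gamma_Lie\<close>, since
    \<open>J\<close> is the second.\<close>
  have "Lie_commutator K G J (carrier G) = {\<zero>\<^bsub>G\<^esub>}"
    using class_2 by (simp add: Lie_nilpotent_of_class_def numeral_2_eq_2)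
  then show "j \<in> Z_Lie G"
    using Lie_commutatorI[OF j, of _ "carrier G"] J_closed[OF j]
    by (auto simp: Z_Lie_def lie_sym_commute[of _ j])
qed

text \<open>The first product vanishes by the Leibniz identity. Their sum vanishes because
  \<open>J\<close> lies in \<open>Z_Lie G\<close>, and this leaves the second product.\<close>

lemma J_bracket:
  assumes "j \<in> J" "x \<in> carrier G"
  shows "x \<otimes>\<^bsub>G\<^esub> j = \<zero>\<^bsub>G\<^esub>" "j \<otimes>\<^bsub>G\<^esub> x = \<zero>\<^bsub>G\<^esub>"
proof -
  show *: "x \<otimes>\<^bsub>G\<^esub> j = \<zero>\<^bsub>G\<^esub>"
    using assms by (intro bracket_Lie_commutator)
  have "lie_sym G x j = \<zero>\<^bsub>G\<^esub>"
    using assms J_le_Z_Lie by (auto simp: Z_Lie_def)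
  then show "j \<otimes>\<^bsub>G\<^esub> x = \<zero>\<^bsub>G\<^esub>"
    using * assms by (simp add: lie_sym_def bracket_closed J_closed)
qed

lemma D_closed:
  assumes "d \<in> D" "x \<in> carrier G"
  shows "d x \<in> carrier G" "d x \<in> Z_Lie G"
  using assms by (auto simp: Lie_derivations_def linear_maps_def)

text \<open>On a generator of \<open>J\<close> both terms of the derivation identity have an
  argument in \<open>Z_Lie G\<close>. To pass to the generated ideal, the zeros of \<open>d\<close>
  must form an ideal. As \<open>d\<close> respects only the symmetrized bracket, its whole kernel
  need not be one, but its zeros inside \<open>J\<close> are, because all brackets with elements of
  \<open>J\<close> are zero.\<close>

lemma D_vanishes_on_J:
  assumes d: "d \<in> D" and j: "j \<in> J"
  shows "d j = \<zero>\<^bsub>G\<^esub>"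
proof -
  have lin: "d \<in> linear_maps K G G"
    using d by (simp add: Lie_derivations_def)
  have d0: "d \<zero>\<^bsub>G\<^esub> = \<zero>\<^bsub>G\<^esub>"
    using linear_map_zero[OF lin G.module_axioms] .
  let ?I = "{j \<in> J. d j = \<zero>\<^bsub>G\<^esub>}"
  have "submodule ?I K G"
    using submoduleE(1,4,5)[OF J_submodule] submodule_zero[OF J_submodule] d0 lin
    by (intro submoduleI_smult) (auto simp: linear_maps_def J_closed)
  then have "bracket_ideal K G ?I"
    using submodule_zero[OF J_submodule] d0 by (auto simp: bracket_ideal_def J_bracket)
  moreover have "lie_sym G x y \<in> ?I" if xy: "x \<in> carrier G" "y \<in> carrier G" for x y
  proof -
    \<comment> \<open>The first summand is written with its arguments swapped, so that the value of
      \<open>d\<close> stands in the second slot, as in \<open>Z_Lie_def\<close>.\<close>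
    have "d (lie_sym G x y) = lie_sym G y (d x) \<oplus>\<^bsub>G\<^esub> lie_sym G x (d y)"
      using d xy D_closed(1)[OF d] by (simp add: Lie_derivations_def lie_sym_commute[of y])
    also have "\<dots> = \<zero>\<^bsub>G\<^esub>"
      using D_closed(2)[OF d] xy by (simp add: Z_Lie_def)
    finally show ?thesis
      using xy by (simp add: Lie_commutatorI)
  qed
  ultimately have "J \<subseteq> ?I"
    by (rule Lie_commutator_minimal)
  with j show ?thesis by auto
qed

lemma S_iff:
  "f \<in> S \<longleftrightarrow> f \<in> linear_maps K G G \<and> f ` carrier G \<subseteq> J \<and> (\<forall>z\<in>Z_Lie G. f z = \<zero>\<^bsub>G\<^esub>)"
  using J_closed by (auto simp: subalg_def linear_maps_def PiE_def Pi_def)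

lemma S_in_J: "\<lbrakk>f \<in> S; x \<in> carrier G\<rbrakk> \<Longrightarrow> f x \<in> J"
  unfolding S_iff by auto

lemma S_closed: "\<lbrakk>f \<in> S; x \<in> carrier G\<rbrakk> \<Longrightarrow> f x \<in> carrier G"
  using S_in_J J_closed by blast

lemma S_vanishes: "\<lbrakk>f \<in> S; z \<in> Z_Lie G\<rbrakk> \<Longrightarrow> f z = \<zero>\<^bsub>G\<^esub>"
  unfolding S_iff by auto

text \<open>Both sides of the derivation identity are zero: \<open>f\<close> kills
  \<open>lie_sym G x y\<close>, which lies in \<open>J\<close> and hence in \<open>Z_Lie G\<close>,
  and the values of \<open>f\<close> lie in \<open>Z_Lie G\<close> as well.\<close>

lemma S_le_D: "S \<subseteq> D"
proof
  fix f assume f: "f \<in> S"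
  have Z: "f x \<in> Z_Lie G" if "x \<in> carrier G" for x
    using S_in_J[OF f that] J_le_Z_Lie by auto
  have "f (lie_sym G x y) = lie_sym G (f x) y \<oplus>\<^bsub>G\<^esub> lie_sym G x (f y)"
    if xy: "x \<in> carrier G" "y \<in> carrier G" for x y
  proof -
    have "lie_sym G x y \<in> Z_Lie G"
      using Lie_commutatorI[OF xy] J_le_Z_Lie by auto
    then have "f (lie_sym G x y) = \<zero>\<^bsub>G\<^esub>"
      by (rule S_vanishes[OF f])
    moreover have "lie_sym G y (f x) = \<zero>\<^bsub>G\<^esub>" "lie_sym G x (f y) = \<zero>\<^bsub>G\<^esub>"
      using Z xy by (auto simp: Z_Lie_def)
    ultimately show ?thesis
      using xy S_closed[OF f] by (simp add: lie_sym_commute[of _ y])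
  qed
  then show "f \<in> D"
    using f Z unfolding S_iff Lie_derivations_def by auto
qed

section \<open>The linear structure of \<open>D\<close> and \<open>S\<close> inside the
  endomorphisms of \<open>G\<close>\<close>

lemma T_module: "module K (T_algebra K G G)"
  by (rule T_algebra_module[OF G.module_axioms])

lemma T_simps:
  "carrier (T_algebra K G G) = linear_maps K G G"
  "\<zero>\<^bsub>T_algebra K G G\<^esub> = (\<lambda>x\<in>carrier G. \<zero>\<^bsub>G\<^esub>)"
  "f \<oplus>\<^bsub>T_algebra K G G\<^esub> g = (\<lambda>x\<in>carrier G. f x \<oplus>\<^bsub>G\<^esub> g x)"
  "a \<odot>\<^bsub>T_algebra K G G\<^esub> f = (\<lambda>x\<in>carrier G. a \<odot>\<^bsub>G\<^esub> f x)"
  by (simp_all add: T_algebra_def)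

lemma D_submodule: "submodule D K (T_algebra K G G)"
proof -
  interpret T: module K "T_algebra K G G" by (rule T_module)
  \<comment> \<open>For maps with values in \<open>Z_Lie G\<close> the right side of the derivation
    identity is zero. The identity thus becomes vanishing on all \<open>lie_sym G x y\<close>, a
    condition visibly stable under sums and scalar multiples.\<close>
  have DI: "f \<in> D"
    if "f \<in> carrier (T_algebra K G G)" "\<And>x. x \<in> carrier G \<Longrightarrow> f x \<in> Z_Lie G"
      "\<And>x y. \<lbrakk>x \<in> carrier G; y \<in> carrier G\<rbrakk> \<Longrightarrow> f (lie_sym G x y) = \<zero>\<^bsub>G\<^esub>" for f
  proof -
    have "lie_sym G (f x) y = \<zero>\<^bsub>G\<^esub>" "lie_sym G x (f y) = \<zero>\<^bsub>G\<^esub>"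
      if "x \<in> carrier G" "y \<in> carrier G" for x y
      using that \<open>\<And>x. x \<in> carrier G \<Longrightarrow> f x \<in> Z_Lie G\<close>
      by (auto simp: Z_Lie_def lie_sym_commute[of _ y])
    then show ?thesis
      using that by (auto simp: Lie_derivations_def T_simps)
  qed
  have van: "d (lie_sym G x y) = \<zero>\<^bsub>G\<^esub>" if "d \<in> D" "x \<in> carrier G" "y \<in> carrier G" for d x y
    using that by (intro D_vanishes_on_J Lie_commutatorI)
  have sub: "D \<subseteq> carrier (T_algebra K G G)"
    by (auto simp: T_simps Lie_derivations_def)
  show ?thesis
  proof (rule T.submoduleI_smult[OF sub])
    show "\<zero>\<^bsub>T_algebra K G G\<^esub> \<in> D"
      using submodule_zero[OF submodule_Z_Lie]
      by (intro DI T.zero_closed) (simp_all add: T_simps)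
  next
    fix d e assume de: "d \<in> D" "e \<in> D"
    then show "d \<oplus>\<^bsub>T_algebra K G G\<^esub> e \<in> D"
      using sub submoduleE(5)[OF submodule_Z_Lie] D_closed(2)[OF de(1)] D_closed(2)[OF de(2)]
        van[OF de(1)] van[OF de(2)]
      by (intro DI T.a_closed) (auto simp: T_simps)
  next
    fix a d assume ad: "a \<in> carrier K" "d \<in> D"
    then show "a \<odot>\<^bsub>T_algebra K G G\<^esub> d \<in> D"
      using sub submoduleE(4)[OF submodule_Z_Lie] D_closed(2)[OF ad(2)] van[OF ad(2)]
      by (intro DI T.smult_closed) (auto simp: T_simps)
  qed
qed

lemma S_submodule: "submodule S K (T_algebra K G G)"
proof -
  interpret T: module K "T_algebra K G G" by (rule T_module)
  have SI: "f \<in> S"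
    if "f \<in> carrier (T_algebra K G G)" "\<And>x. x \<in> carrier G \<Longrightarrow> f x \<in> J"
      "\<And>z. z \<in> Z_Lie G \<Longrightarrow> f z = \<zero>\<^bsub>G\<^esub>" for f
    using that unfolding S_iff by (auto simp: T_simps)
  have sub: "S \<subseteq> carrier (T_algebra K G G)"
    unfolding T_simps using S_iff by blast
  have Z: "z \<in> carrier G" if "z \<in> Z_Lie G" for z
    using that by (simp add: Z_Lie_def)
  show ?thesis
  proof (rule T.submoduleI_smult[OF sub])
    show "\<zero>\<^bsub>T_algebra K G G\<^esub> \<in> S"
      using submodule_zero[OF J_submodule]
      by (intro SI T.zero_closed) (simp_all add: T_simps Z)
  next
    fix d e assume de: "d \<in> S" "e \<in> S"
    then show "d \<oplus>\<^bsub>T_algebra K G G\<^esub> e \<in> S"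
      using sub submoduleE(5)[OF J_submodule] S_in_J[OF de(1)] S_in_J[OF de(2)]
        S_vanishes[OF de(1)] S_vanishes[OF de(2)]
      by (intro SI T.a_closed) (auto simp: T_simps Z)
  next
    fix a d assume ad: "a \<in> carrier K" "d \<in> S"
    then show "a \<odot>\<^bsub>T_algebra K G G\<^esub> d \<in> S"
      using sub submoduleE(4)[OF J_submodule] S_in_J[OF ad(2)] S_vanishes[OF ad(2)]
      by (intro SI T.smult_closed) (auto simp: T_simps Z)
  qed
qed

section \<open>The bracket of \<open>Der_z_Lie K G\<close> and the central subalgebra
  \<open>S\<close>\<close>

lemma Der_z_simps:
  "carrier (Der_z_Lie K G) = D"
  "\<zero>\<^bsub>Der_z_Lie K G\<^esub> = \<zero>\<^bsub>T_algebra K G G\<^esub>"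
  "f \<oplus>\<^bsub>Der_z_Lie K G\<^esub> g = f \<oplus>\<^bsub>T_algebra K G G\<^esub> g"
  "a \<odot>\<^bsub>Der_z_Lie K G\<^esub> f = a \<odot>\<^bsub>T_algebra K G G\<^esub> f"
  "f \<otimes>\<^bsub>Der_z_Lie K G\<^esub> g = (\<lambda>x\<in>carrier G. f (g x) \<ominus>\<^bsub>G\<^esub> g (f x))"
  by (simp_all add: Der_z_Lie_def Der_Lie_def subalg_def)

text \<open>The two composites vanish separately: \<open>d\<close> maps into \<open>Z_Lie G\<close>,
  which \<open>f\<close> kills, and \<open>f\<close> maps into \<open>J\<close>, which
  \<open>d\<close> kills.\<close>

lemma S_central:
  assumes f: "f \<in> S" and d: "d \<in> D"
  shows "f \<otimes>\<^bsub>Der_z_Lie K G\<^esub> d = \<zero>\<^bsub>T_algebra K G G\<^esub>" "d \<otimes>\<^bsub>Der_z_Lie K G\<^esub> f = \<zero>\<^bsub>T_algebra K G G\<^esub>"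
proof -
  have "f (d x) = \<zero>\<^bsub>G\<^esub>" "d (f x) = \<zero>\<^bsub>G\<^esub>" if "x \<in> carrier G" for x
    using S_vanishes[OF f D_closed(2)[OF d that]] D_vanishes_on_J[OF d S_in_J[OF f that]]
    by simp_all
  then show "f \<otimes>\<^bsub>Der_z_Lie K G\<^esub> d = \<zero>\<^bsub>T_algebra K G G\<^esub>" "d \<otimes>\<^bsub>Der_z_Lie K G\<^esub> f = \<zero>\<^bsub>T_algebra K G G\<^esub>"
    unfolding Der_z_simps T_simps by (auto simp: a_minus_def intro!: restrict_ext)
qed

lemma S_subalgebra: "bracket_subalgebra K (Der_z_Lie K G) S"
proof -
  interpret T: module K "T_algebra K G G" by (rule T_module)
  \<comment> \<open>Brings the record into the shape required by \<open>submodule_incl\<close>, with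
    \<open>T_algebra K G G\<close> as the ambient module.\<close>
  have "Der_z_Lie K G = (T_algebra K G G)
      \<lparr>mult := \<lambda>d e. \<lambda>x\<in>carrier G. d (e x) \<ominus>\<^bsub>G\<^esub> e (d x), carrier := D\<rparr>"
    by (simp add: Der_z_Lie_def Der_Lie_def subalg_def)
  then have "submodule S K (Der_z_Lie K G)"
    using T.submodule_incl[OF S_submodule D_submodule S_le_D] by presburger
  moreover have "f \<otimes>\<^bsub>Der_z_Lie K G\<^esub> g \<in> S" if "f \<in> S" "g \<in> S" for f g
    unfolding S_central(1)[OF that(1) subsetD[OF S_le_D that(2)]]
    by (rule T.submodule_zero[OF S_submodule])
  ultimately show ?thesis
    unfolding bracket_subalgebra_def by blast
qed

lemma S_le_center: "S \<subseteq> bracket_center (Der_z_Lie K G)"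
proof
  fix f assume f: "f \<in> S"
  then show "f \<in> bracket_center (Der_z_Lie K G)"
    using S_central[OF f] S_le_D
    unfolding bracket_center_def Der_z_simps(1,2) by blast
qed

text \<open>The sum of the two multiplications by \<open>x\<close> sends \<open>y\<close> to
  \<open>lie_sym G y x\<close>. This is a generator of \<open>J\<close>, and it is zero for
  \<open>y\<close> in \<open>Z_Lie G\<close> by symmetry.\<close>

lemma RL_image_le_S: "RL_image K G \<subseteq> S"
proof
  fix f assume "f \<in> RL_image K G"
  then obtain x where x: "x \<in> carrier G" and "f = R_op G x \<oplus>\<^bsub>T_algebra K G G\<^esub> L_op G x"
    by (auto simp: RL_image_def)
  then have f: "f = (\<lambda>y\<in>carrier G. lie_sym G y x)"
    by (auto simp: T_simps R_op_def L_op_def lie_sym_def intro!: restrict_ext)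
  have "f z = \<zero>\<^bsub>G\<^esub>" if "z \<in> Z_Lie G" for z
    using that x by (auto simp: f Z_Lie_def lie_sym_commute[of _ x])
  then show "f \<in> S"
    unfolding S_iff using x
    by (auto simp: f linear_maps_def lie_sym_add_left lie_sym_smult_left intro: Lie_commutatorI)
qed

text \<open>Bijectivity is \<open>quotient_lift_bij\<close> for \<open>Z_Lie G\<close> and the
  module \<open>subalg G J\<close>; what remains is compatibility with the operations. The
  restriction to \<open>S\<close> makes the map extensional, as \<open>bracket_iso\<close>
  requires.\<close>

lemma S_iso:
  "restrict (quotient_lift (Z_Lie G)) S \<in> bracket_iso K (subalg (Der_z_Lie K G) S)
     (T_algebra K (quotient_algebra G (Z_Lie G)) (subalg G J))"
proof -
  let ?Q = "quotient_algebra G (Z_Lie G)" and ?B = "subalg G J"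
  let ?T = "T_algebra K ?Q ?B" and ?\<phi> = "quotient_lift (Z_Lie G)"
  interpret T: module K "T_algebra K G G" by (rule T_module)
  have B: "module K ?B"
    unfolding subalg_def by (rule submodule.submodule_is_module[OF J_submodule G.module_axioms])
  note bij = quotient_lift_bij[OF submodule_Z_Lie B]
  have coset: "?\<phi> f (Z_Lie G +>\<^bsub>G\<^esub> x) = f x" if "f \<in> S" "x \<in> carrier G" for f x
    using that by (intro quotient_lift_coset[OF submodule_Z_Lie B]) auto
  \<comment> \<open>To identify a lift with a function \<open>h\<close> of cosets, it suffices to
    compare on representatives. The choices of \<open>h\<close> below are the pointwise sum, scalar
    multiple and bracket of lifts.\<close>
  have ext: "?\<phi> f = (\<lambda>C\<in>carrier ?Q. h C)"
    if "f \<in> S" "\<And>x. x \<in> carrier G \<Longrightarrow> f x = h (Z_Lie G +>\<^bsub>G\<^esub> x)" for f h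
  proof (rule extensionalityI[of _ "carrier ?Q"])
    fix C assume "C \<in> carrier ?Q"
    then show "?\<phi> f C = (\<lambda>C\<in>carrier ?Q. h C) C"
      using that by (auto simp: quotient_algebra_simps(1)[OF submodule_Z_Lie] coset)
  qed (simp_all add: quotient_lift_def)
  have S_ops: "\<zero>\<^bsub>T_algebra K G G\<^esub> \<in> S"
    "f \<in> S \<Longrightarrow> g \<in> S \<Longrightarrow> f \<oplus>\<^bsub>T_algebra K G G\<^esub> g \<in> S"
    "a \<in> carrier K \<Longrightarrow> f \<in> S \<Longrightarrow> a \<odot>\<^bsub>T_algebra K G G\<^esub> f \<in> S" for a f g
    using T.submodule_zero[OF S_submodule] T.submoduleE(4,5)[OF S_submodule] by blast+
  have add: "?\<phi> (f \<oplus>\<^bsub>T_algebra K G G\<^esub> g) = ?\<phi> f \<oplus>\<^bsub>?T\<^esub> ?\<phi> g" if "f \<in> S" "g \<in> S" for f g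
  proof -
    have "?\<phi> (f \<oplus>\<^bsub>T_algebra K G G\<^esub> g) = (\<lambda>C\<in>carrier ?Q. ?\<phi> f C \<oplus>\<^bsub>G\<^esub> ?\<phi> g C)"
      using coset[OF that(1)] coset[OF that(2)]
      by (intro ext S_ops that) (simp add: T_simps)
    then show ?thesis by (simp add: T_algebra_def subalg_def)
  qed
  have smult: "?\<phi> (a \<odot>\<^bsub>T_algebra K G G\<^esub> f) = a \<odot>\<^bsub>?T\<^esub> ?\<phi> f" if "a \<in> carrier K" "f \<in> S" for a f
  proof -
    have "?\<phi> (a \<odot>\<^bsub>T_algebra K G G\<^esub> f) = (\<lambda>C\<in>carrier ?Q. a \<odot>\<^bsub>G\<^esub> ?\<phi> f C)"
      using coset[OF that(2)]
      by (intro ext S_ops that) (simp add: T_simps)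
    then show ?thesis by (simp add: T_algebra_def subalg_def)
  qed
  have mult: "?\<phi> (f \<otimes>\<^bsub>Der_z_Lie K G\<^esub> g) = ?\<phi> f \<otimes>\<^bsub>?T\<^esub> ?\<phi> g" if "f \<in> S" "g \<in> S" for f g
  proof -
    \<comment> \<open>Both brackets are zero: the commutator in \<open>S\<close> by centrality, the
      pointwise one because the values lie in \<open>J\<close>, where \<open>J_bracket\<close>
      applies.\<close>
    have "?\<phi> \<zero>\<^bsub>T_algebra K G G\<^esub> = (\<lambda>C\<in>carrier ?Q. ?\<phi> f C \<otimes>\<^bsub>G\<^esub> ?\<phi> g C)"
      using coset[OF that(1)] coset[OF that(2)] S_in_J[OF that(1)] S_closed[OF that(2)]
      by (intro ext S_ops) (simp add: T_simps J_bracket)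
    then show ?thesis
      using S_central(1)[OF that(1) subsetD[OF S_le_D that(2)]]
      by (simp add: T_algebra_def subalg_def)
  qed
  have car: "carrier (subalg (Der_z_Lie K G) S) = S"
    and ops: "\<And>f g. f \<oplus>\<^bsub>subalg (Der_z_Lie K G) S\<^esub> g = f \<oplus>\<^bsub>T_algebra K G G\<^esub> g"
      "\<And>a f. a \<odot>\<^bsub>subalg (Der_z_Lie K G) S\<^esub> f = a \<odot>\<^bsub>T_algebra K G G\<^esub> f"
      "\<And>f g. f \<otimes>\<^bsub>subalg (Der_z_Lie K G) S\<^esub> g = f \<otimes>\<^bsub>Der_z_Lie K G\<^esub> g"
    by (simp_all add: subalg_def Der_z_simps)
  have T: "carrier ?T = linear_maps K ?Q ?B"
    by (simp add: T_algebra_def)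
  have Smult: "f \<otimes>\<^bsub>Der_z_Lie K G\<^esub> g \<in> S" if "f \<in> S" "g \<in> S" for f g
    using S_subalgebra that unfolding bracket_subalgebra_def by blast
  have "restrict ?\<phi> S \<in> S \<rightarrow>\<^sub>E carrier ?T"
    using bij unfolding T by (intro restrict_PiE_iff[THEN iffD2]) (blast dest: bij_betwE)
  moreover have "bij_betw (restrict ?\<phi> S) S (carrier ?T)"
    using bij unfolding T by (simp add: bij_betw_cong[of S "restrict ?\<phi> S" ?\<phi>])
  ultimately show ?thesis
    unfolding bracket_iso_def linear_maps_def[of K "subalg (Der_z_Lie K G) S"] car ops
    using S_ops Smult add smult mult by simp
qed

end

theorem corollary3p8:
  fixes K :: "('k, 'm) ring_scheme" and Q :: "('k, 'a, 'n) module_scheme"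
  assumes "leibniz_algebra K Q"
    and "\<one>\<^bsub>K\<^esub> \<oplus>\<^bsub>K\<^esub> \<one>\<^bsub>K\<^esub> \<in> Units K"
    and "Lie_nilpotent_of_class K Q 2"
  shows "\<exists>S. bracket_subalgebra K (Der_z_Lie K Q) S \<and>
             S \<subseteq> bracket_center (Der_z_Lie K Q) \<and>
             bracket_iso K (subalg (Der_z_Lie K Q) S)
               (T_algebra K (quotient_algebra Q (Z_Lie Q))
                  (subalg Q (Lie_commutator K Q (carrier Q) (carrier Q)))) \<noteq> {} \<and>
             RL_image K Q \<subseteq> S"
proof -
  interpret leibniz_algebra_class_2 K Q
    using assms by (intro leibniz_algebra_class_2.intro leibniz_algebra_class_2_axioms.intro)
  show ?thesis
    using S_subalgebra S_le_center S_iso RL_image_le_S by blast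
qed

end
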